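(* Let $n\ge1$ and let $b_k(x)=B_k(x)/k!$ be the factorially normalized Bernoulli polynomials. The probability density of the sum, in the circle $\mathbb{T}=\mathbb{R}/\mathbb{Z}$, of $n$ independent beta$(1,2)$ random variables (i.e. of the fractional part of their real sum) is $$(1-2b_1)^{\circledast n}(u)=1-2^n b_n(u),\qquad u\in\mathbb{T}=[0,1).$$
   Context: The Bernoulli polynomials $B_n(x)$ are defined by $\frac{\lambda e^{\lambda x}}{e^\lambda-1}=\sum_{n\ge0}\frac{B_n(x)}{n!}\lambda^n$ for $|\lambda|<2\pi$; in particular $b_1(x)=x-\frac12$. The beta$(1,2)$ distribution has density $2(1-x)$ on $(0,1)$. For integrable $f,g$ on $[0,1)$, the circular convolution is $(f\circledast g)(u)=\int_0^1 f(v)\,g(u-v)\,dv$, where $u-v$ is taken modulo $1$ in $[0,1)$, and $f^{\circledast n}$ denotes the $n$-fold circular convolution of $f$ with itself ($f^{\circledast 1}=f$). Densities are with respect to Lebesgue measure. *)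

theory Defs
  imports "HOL-Probability.Probability" "HOL-Complex_Analysis.Complex_Analysis"
begin

text \<open>
  The generating function is taken as a formal power series in \<open>\<lambda>\<close>; the numerator and
  the denominator both vanish at \<open>\<lambda> = 0\<close>, and \<open>/\<close> is the exact quotient of formal power
  series. That the analytic expansion on \<open>\<bar>\<lambda>\<bar> < 2\<pi>\<close> holds is \<open>bernpoly_sums\<close> below.
\<close>
definition bernpoly :: "nat \<Rightarrow> real \<Rightarrow> real" where
  "bernpoly n x = fact n * fps_nth (fps_X * fps_exp x / (fps_exp 1 - 1)) n"

definition norm_bernpoly :: "nat \<Rightarrow> real \<Rightarrow> real" where
  "norm_bernpoly k x = bernpoly k x / fact k"

text \<open>The representative of \<open>u - v\<close> modulo 1 in \<open>[0,1)\<close> is \<open>frac (u - v)\<close>.\<close>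
definition circ_conv :: "(real \<Rightarrow> real) \<Rightarrow> (real \<Rightarrow> real) \<Rightarrow> real \<Rightarrow> real"  (infixl "\<circledast>" 70) where
  "(f \<circledast> g) u = (LBINT v:{0..<1}. f v * g (frac (u - v)))"

text \<open>
  The \<open>n\<close>-fold convolution has \<open>n\<close> factors and is only meaningful for \<open>n \<ge> 1\<close>: the convolution
  has no unit among functions, and the value at \<open>n = 0\<close> is junk.
\<close>
definition circ_conv_pow :: "(real \<Rightarrow> real) \<Rightarrow> nat \<Rightarrow> real \<Rightarrow> real" where
  "circ_conv_pow f n = (((\<circledast>) f) ^^ (n - 1)) f"

definition beta_1_2_density :: "real \<Rightarrow> real" where
  "beta_1_2_density x = (if 0 < x \<and> x < 1 then 2 * (1 - x) else 0)"

text \<open>The circle, represented by \<open>[0,1)\<close> with Lebesgue measure.\<close>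
definition circle_lborel :: "real measure" where
  "circle_lborel = restrict_space lborel {0..<1}"

lemma circ_conv_pow_1: "circ_conv_pow f 1 = f"
  by (simp add: circ_conv_pow_def)

lemma circ_conv_pow_Suc: "n \<ge> 1 \<Longrightarrow> circ_conv_pow f (Suc n) = f \<circledast> circ_conv_pow f n"
  by (cases n) (simp_all add: circ_conv_pow_def)

lemma norm_bernpoly_altdef:
  "norm_bernpoly n x = fps_nth (fps_X * fps_exp x / (fps_exp 1 - 1)) n"
  by (simp add: norm_bernpoly_def bernpoly_def)

lemma fps_exp_minus_1_subdegree:
  "subdegree (fps_exp 1 - 1 :: 'a :: field_char_0 fps) = 1"
  by (rule subdegreeI) auto

lemma fps_exp_minus_1_dvd:
  "(fps_exp 1 - 1) dvd fps_X * (F :: 'a :: field_char_0 fps)"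
proof -
  have "(fps_exp 1 - 1 :: 'a fps) dvd fps_X"
    using fps_exp_minus_1_subdegree[where 'a = 'a]
    by (subst fps_dvd_iff) (auto dest: arg_cong[of _ _ subdegree])
  thus ?thesis by simp
qed

lemma norm_bernpoly_fps_of_real:
  "Abs_fps (\<lambda>n. of_real (norm_bernpoly n x)) =
     (fps_X * fps_exp (of_real x) / (fps_exp 1 - 1) :: complex fps)"
proof -
  define F where "F = (fps_X * fps_exp x / (fps_exp 1 - 1) :: real fps)"
  have F: "F * (fps_exp 1 - 1) = fps_X * fps_exp x"
    unfolding F_def by (rule dvd_div_mult_self) (rule fps_exp_minus_1_dvd)
  have "Abs_fps (\<lambda>n. of_real (fps_nth F n)) * (fps_exp 1 - 1) = 
          (fps_X * fps_exp (of_real x) :: complex fps)"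
  proof (rule fps_ext)
    fix n
    have "fps_nth (Abs_fps (\<lambda>n. of_real (fps_nth F n)) * (fps_exp 1 - 1)) n =
            (of_real (fps_nth (F * (fps_exp 1 - 1)) n) :: complex)"
      unfolding fps_mult_nth of_real_sum
      by (intro sum.cong refl) auto
    also have "\<dots> = fps_nth (fps_X * fps_exp (of_real x)) n"
      unfolding F by simp
    finally show "fps_nth (Abs_fps (\<lambda>n. of_real (fps_nth F n)) * (fps_exp 1 - 1)) n =
                    (fps_nth (fps_X * fps_exp (of_real x)) n :: complex)" .
  qed
  moreover have "(fps_exp 1 - 1 :: complex fps) \<noteq> 0"
    using fps_exp_minus_1_subdegree[where 'a = complex] by auto
  ultimately have "Abs_fps (\<lambda>n. of_real (fps_nth F n)) =
                     (fps_X * fps_exp (of_real x) / (fps_exp 1 - 1) :: complex fps)"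
    by (metis nonzero_mult_div_cancel_right)
  thus ?thesis
    by (simp add: F_def norm_bernpoly_altdef)
qed

theorem bernpoly_sums:
  fixes l :: complex
  assumes "l \<noteq> 0" "norm l < 2 * pi"
  shows   "(\<lambda>n. of_real (bernpoly n x) / fact n * l ^ n) sums
             (l * exp (l * of_real x) / (exp l - 1))"
proof -
  define G where "G = (\<lambda>z::complex. if z = 0 then 1 else z * exp (of_real x * z) / (exp z - 1))"
  define F where "F = (fps_X * fps_exp (of_real x) / (fps_exp 1 - 1) :: complex fps)"
  have nz: "exp z \<noteq> 1" if "z \<noteq> 0" "norm z < 2 * pi" for z :: complex
  proof
    assume "exp z = 1"
    then obtain k :: int where k: "Re z = 0" "Im z = of_int (2 * k) * pi"
      by (auto simp: exp_eq_1)
    have "k \<noteq> 0" using k that(1) by (auto simp: complex_eq_iff)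
    hence "1 \<le> real_of_int \<bar>k\<bar>" by linarith
    hence "2 * pi \<le> \<bar>Im z\<bar>" unfolding k by (simp add: abs_mult)
    also have "\<dots> \<le> norm z" by (rule abs_Im_le_cmod)
    finally show False using that by simp
  qed
  have "fps_exp 1 - 1 \<noteq> (0 :: complex fps)"
    using fps_exp_minus_1_subdegree[where 'a = complex] by auto
  hence exp_G: "G has_fps_expansion F"
    unfolding G_def F_def
    by (intro has_fps_expansion_divide fps_expansion_intros)
       (simp_all only: fps_exp_minus_1_subdegree, simp_all)
  have "G holomorphic_on ball 0 (2 * pi)"
  proof (rule no_isolated_singularity)
    have *: "(\<lambda>z. z * exp (of_real x * z) / (exp z - 1)) holomorphic_on ball 0 (2 * pi) - {0}"
      by (intro holomorphic_intros) (use nz in auto)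
    also have "?this \<longleftrightarrow> G holomorphic_on ball 0 (2 * pi) - {0}"
      by (intro holomorphic_cong) (auto simp: G_def)
    finally show holo: "G holomorphic_on ball 0 (2 * pi) - {0}" .
    have "isCont G z" if "z \<in> ball 0 (2 * pi)" for z
    proof (cases "z = 0")
      case True
      thus ?thesis using has_fps_expansion_imp_continuous[OF exp_G, of UNIV] by simp
    next
      case False
      have "open (ball 0 (2 * pi) - {0::complex})" by (intro open_delete) auto
      thus ?thesis
        using holomorphic_on_imp_continuous_on[OF holo] that False
        by (metis DiffI continuous_on_eq_continuous_at singletonD)
    qed
    thus "continuous_on (ball 0 (2 * pi)) G"
      by (intro continuous_at_imp_continuous_on) auto
  qed auto
  hence "(\<lambda>n. fps_nth F n * l ^ n) sums G l"
    using assms by (intro has_fps_expansion_imp_sums_complex[OF exp_G, of "ereal (2 * pi)"]) simp_all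
  moreover have "fps_nth F n = of_real (bernpoly n x) / fact n" for n
    unfolding F_def norm_bernpoly_fps_of_real [symmetric]
    by (simp add: norm_bernpoly_def)
  ultimately show ?thesis
    using assms by (simp add: G_def mult_ac)
qed

lemma norm_bernpoly_1: "norm_bernpoly 1 x = x - 1 / 2"
proof -
  define F where "F = (fps_X * fps_exp x / (fps_exp 1 - 1) :: real fps)"
  have F: "F * (fps_exp 1 - 1) = fps_X * fps_exp x"
    unfolding F_def by (rule dvd_div_mult_self) (rule fps_exp_minus_1_dvd)
  have "fps_nth (F * (fps_exp 1 - 1)) 1 = 1" "fps_nth (F * (fps_exp 1 - 1)) 2 = x"
    unfolding F by simp_all
  thus ?thesis
    unfolding norm_bernpoly_altdef F_def [symmetric]
    by (simp add: fps_mult_nth numeral_2_eq_2)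
qed

end

theory Submission
  imports Defs
begin

text \<open>
  Write \<open>b\<^sub>n\<close> for the normalized Bernoulli polynomials. Comparing coefficients in the generating
  function gives \<open>b\<^sub>n\<^sub>+\<^sub>1' = b\<^sub>n\<close> and \<open>b\<^sub>n(1) = b\<^sub>n(0)\<close> for \<open>n \<ge> 2\<close>. After an
  integration by parts on \<open>[0,u]\<close> and on \<open>[u,1]\<close>, these two facts give \<open>(2(1 - x) \<circledast> b\<^sub>n)(u) = 2 b\<^sub>n\<^sub>+\<^sub>1(u)\<close> for \<open>n \<ge> 1\<close>. As
  \<open>2(1 - x)\<close> has integral 1 over \<open>[0,1]\<close>, the closed form \<open>1 - 2\<^sup>n b\<^sub>n\<close> of the convolution powers of
  \<open>1 - 2 b\<^sub>1 = 2(1 - x)\<close> follows by induction on \<open>n\<close> (\<open>has_bochner_integral_conv_bernoulli\<close>, \<open>circ_conv_pow_eq_norm_bernpoly\<close>).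
  The powers are nonnegative on \<open>[0,1)\<close> because \<open>1 - 2 b\<^sub>1\<close> is.

  On the probabilistic side, the translation invariance of Lebesgue measure on the circle and
  Tonelli's theorem show that the fractional part of a sum of two independent variables has the
  circular convolution of the densities as its density (\<open>distributed_frac_add\<close>). As
  \<open>frac (X\<^sub>n\<^sub>+\<^sub>1 + S\<^sub>n) = frac (X\<^sub>n\<^sub>+\<^sub>1 + frac S\<^sub>n)\<close> for the partial sums \<open>S\<^sub>n\<close>, induction on \<open>n\<close> applies
  again; the values of the beta density at the endpoints of the interval do not matter.
\<close>

section \<open>Normalized Bernoulli polynomials\<close>

lemma norm_bernpoly_eq_sum:
  "norm_bernpoly n x = (\<Sum>i\<le>n. x ^ i / fact i * norm_bernpoly (n - i) 0)"
proof -
  have "fps_X * fps_exp x / (fps_exp 1 - 1) = fps_exp x * (fps_X * fps_exp 0 / (fps_exp 1 - 1))"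
    using fps_exp_minus_1_dvd[of "1::real fps"] by (simp add: div_mult_swap mult_ac)
  thus ?thesis
    unfolding norm_bernpoly_altdef by (simp add: fps_mult_nth atLeast0AtMost)
qed

lemma has_real_derivative_norm_bernpoly:
  "(norm_bernpoly (Suc n) has_real_derivative norm_bernpoly n x) (at x)"
proof -
  have "((\<lambda>x. \<Sum>i\<le>Suc n. x ^ i / fact i * norm_bernpoly (Suc n - i) 0) has_real_derivative
          (\<Sum>i\<le>Suc n. real i * x ^ (i - 1) / fact i * norm_bernpoly (Suc n - i) 0)) (at x)"
    by (intro DERIV_sum) (auto intro!: derivative_eq_intros)
  moreover have "(\<Sum>i\<le>Suc n. real i * x ^ (i - 1) / fact i * norm_bernpoly (Suc n - i) 0)
                   = norm_bernpoly n x"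
    unfolding sum.atMost_Suc_shift norm_bernpoly_eq_sum[of n x]
    by (auto intro!: sum.cong simp: field_simps simp del: of_nat_Suc)
  ultimately show ?thesis
    by (subst norm_bernpoly_eq_sum[abs_def]) simp
qed

lemmas has_real_derivative_norm_bernpoly' [derivative_intros] =
  DERIV_chain2[OF has_real_derivative_norm_bernpoly]

lemma isCont_norm_bernpoly: "isCont (norm_bernpoly n) x"
  by (subst norm_bernpoly_eq_sum[abs_def]) (intro continuous_intros, simp)

lemma borel_measurable_norm_bernpoly [measurable]: "norm_bernpoly n \<in> borel_measurable borel"
  by (intro borel_measurable_continuous_onI continuous_at_imp_continuous_on ballI isCont_norm_bernpoly)

lemma norm_bernpoly_at_1:
  assumes "n \<ge> 2"
  shows   "norm_bernpoly n 1 = norm_bernpoly n 0"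
proof -
  have nz: "fps_exp 1 - 1 \<noteq> (0 :: real fps)"
    using fps_exp_minus_1_subdegree[where 'a = real] by auto
  have "(fps_X * fps_exp 1 / (fps_exp 1 - 1) - fps_X * fps_exp 0 / (fps_exp 1 - 1)) * (fps_exp 1 - 1)
          = fps_X * (fps_exp 1 - 1 :: real fps)"
    unfolding left_diff_distrib dvd_div_mult_self[OF fps_exp_minus_1_dvd] by (simp add: algebra_simps)
  hence "fps_X * fps_exp 1 / (fps_exp 1 - 1) - fps_X * fps_exp 0 / (fps_exp 1 - 1)
           = (fps_X :: real fps)"
    using mult_right_cancel[OF nz] by blast
  hence "norm_bernpoly n 1 - norm_bernpoly n 0 = fps_nth (fps_X :: real fps) n"
    unfolding norm_bernpoly_altdef by (metis fps_sub_nth)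
  thus ?thesis using assms by simp
qed

section \<open>Circular convolution powers\<close>

lemma frac_diff_unit_interval:
  fixes u v :: real
  assumes "u \<in> {0..<1}" "v \<in> {0..<1}"
  shows   "frac (u - v) = (if v \<le> u then u - v else u - v + 1)"
  using assms by (auto simp: frac_unique_iff)

lemma borel_measurable_frac [measurable]: "(frac :: real \<Rightarrow> real) \<in> borel_measurable borel"
  unfolding frac_def[abs_def] by measurable

lemma has_bochner_integral_conv_norm_bernpoly:
  fixes u :: real
  assumes n: "n \<ge> 1" and u: "u \<in> {0..<1}"
  shows "has_bochner_integral lborel
           (\<lambda>v. indicator {0..<1} v * (2 * (1 - v) * norm_bernpoly n (frac (u - v))))
           (2 * norm_bernpoly (Suc n) u)"
proof -
  \<comment> \<open>With \<open>c = 0\<close> resp. \<open>c = 1\<close>, this is an antiderivative of the integrand left resp. right of \<open>u\<close>.\<close>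
  define A where "A = (\<lambda>c v. 2 * norm_bernpoly (Suc (Suc n)) (u - v + c)
                             - 2 * (1 - v) * norm_bernpoly (Suc n) (u - v + c))"
  define h where "h = (\<lambda>c v. 2 * (1 - v) * norm_bernpoly n (u - v + c))"
  have A: "(A c has_real_derivative h c v) (at v)" for c v
    unfolding A_def h_def by (auto intro!: derivative_eq_intros simp: algebra_simps)
  have h: "isCont (h c) v" for c v
    unfolding h_def by (intro continuous_intros isCont_o2[OF _ isCont_norm_bernpoly])
  have "has_bochner_integral lborel (\<lambda>v. h 0 v * indicator {0..u} v + h 1 v * indicator {u..1} v)
          ((A 0 u - A 0 0) + (A 1 1 - A 1 u))"
    using u by (intro has_bochner_integral_add has_bochner_integral_FTC_Icc_real A h) auto
  also have "(A 0 u - A 0 0) + (A 1 1 - A 1 u) = 2 * norm_bernpoly (Suc n) u"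
    using n by (simp add: A_def norm_bernpoly_at_1)
  also have "has_bochner_integral lborel (\<lambda>v. h 0 v * indicator {0..u} v + h 1 v * indicator {u..1} v)
      (2 * norm_bernpoly (Suc n) u) \<longleftrightarrow> ?thesis"
  proof (rule has_bochner_integral_cong_AE)
    show "AE v in lborel. h 0 v * indicator {0..u} v + h 1 v * indicator {u..1} v =
            indicator {0..<1} v * (2 * (1 - v) * norm_bernpoly n (frac (u - v)))"
      using AE_lborel_singleton[of u] AE_lborel_singleton[of 1]
    proof eventually_elim
      case (elim v)
      thus ?case using u
        by (auto simp: indicator_def h_def frac_diff_unit_interval)
    qed
  qed (unfold h_def, measurable)
  finally show ?thesis .
qed

lemma has_bochner_integral_conv_bernoulli:
  fixes u :: real
  assumes n: "n \<ge> 1" and u: "u \<in> {0..<1}"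
  shows "has_bochner_integral lborel
           (\<lambda>v. indicator {0..<1} v * (2 * (1 - v) * (1 - 2 ^ n * norm_bernpoly n (frac (u - v)))))
           (1 - 2 ^ Suc n * norm_bernpoly (Suc n) u)"
proof -
  have "has_bochner_integral lborel (\<lambda>v::real. 2 * (1 - v) * indicator {0..1} v)
          (- ((1 - 1)\<^sup>2) - (- ((1 - 0)\<^sup>2)))"
    by (intro has_bochner_integral_FTC_Icc_real[where F = "\<lambda>v. - ((1 - v)\<^sup>2)"])
       (auto intro!: derivative_eq_intros simp: field_simps)
  also have "(\<lambda>v::real. 2 * (1 - v) * indicator {0..1} v) = (\<lambda>v. indicator {0..<1} v * (2 * (1 - v)))"
    by (auto simp: indicator_def fun_eq_iff)
  finally have "has_bochner_integral lborel (\<lambda>v::real. indicator {0..<1} v * (2 * (1 - v))) 1"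
    by simp
  hence "has_bochner_integral lborel
           (\<lambda>v. indicator {0..<1} v * (2 * (1 - v)) -
              2 ^ n * (indicator {0..<1} v * (2 * (1 - v) * norm_bernpoly n (frac (u - v)))))
           (1 - 2 ^ n * (2 * norm_bernpoly (Suc n) u))"
    by (intro has_bochner_integral_diff has_bochner_integral_mult_right
              has_bochner_integral_conv_norm_bernpoly n u)
  thus ?thesis by (simp add: algebra_simps)
qed

lemma circ_conv_pow_eq_norm_bernpoly:
  assumes "n \<ge> 1" "u \<in> {0..<1}"
  shows   "circ_conv_pow (\<lambda>x. 1 - 2 * norm_bernpoly 1 x) n u = 1 - 2 ^ n * norm_bernpoly n u"
  using assms
proof (induction n arbitrary: u rule: dec_induct)
  case base
  thus ?case by (simp add: circ_conv_pow_1 del: One_nat_def)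
next
  case (step n)
  let ?f = "\<lambda>x. 1 - 2 * norm_bernpoly 1 x"
  have IH: "circ_conv_pow ?f n (frac x) = 1 - 2 ^ n * norm_bernpoly n (frac x)" for x
    by (rule step.IH) (simp add: frac_lt_1)
  have f: "?f v = 2 * (1 - v)" for v
    by (simp add: norm_bernpoly_1 del: One_nat_def)
  have "circ_conv_pow ?f (Suc n) u =
          (LINT v|lborel. indicator {0..<1} v * (?f v * circ_conv_pow ?f n (frac (u - v))))"
    using step.hyps by (simp add: circ_conv_pow_Suc circ_conv_def set_lebesgue_integral_def)
  also have "\<dots> = (LINT v|lborel. indicator {0..<1} v *
                    (2 * (1 - v) * (1 - 2 ^ n * norm_bernpoly n (frac (u - v)))))"
    unfolding IH unfolding f ..
  also have "\<dots> = 1 - 2 ^ Suc n * norm_bernpoly (Suc n) u"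
    using has_bochner_integral_conv_bernoulli[of n u] step
    by (simp add: has_bochner_integral_iff)
  finally show ?case .
qed

lemma norm_bernpoly_conv_pow_nonneg:
  assumes "n \<ge> 1" "u \<in> {0..<1}"
  shows   "1 - 2 ^ n * norm_bernpoly n u \<ge> 0"
  using assms
proof (induction n arbitrary: u rule: dec_induct)
  case base
  thus ?case by (simp add: norm_bernpoly_1 del: One_nat_def)
next
  case (step n)
  have "0 \<le> indicator {0..<1} v * (2 * (1 - v) * (1 - 2 ^ n * norm_bernpoly n (frac (u - v))))" for v
    using step.IH[of "frac (u - v)"] by (auto simp: indicator_def frac_lt_1)
  with has_bochner_integral_conv_bernoulli[of n u] step show ?case
    by (metis (no_types, lifting) Bochner_Integration.integral_nonneg has_bochner_integral_integral_eq)
qed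

section \<open>Densities of fractional parts\<close>

text \<open>Translation invariance of Lebesgue measure on the circle.\<close>

lemma nn_integral_frac_add:
  fixes h :: "real \<Rightarrow> ennreal"
  assumes [measurable]: "h \<in> borel_measurable borel"
  shows "(\<integral>\<^sup>+y. indicator {0..<1} y * h (frac (x + y)) \<partial>lborel)
           = (\<integral>\<^sup>+u. indicator {0..<1} u * h u \<partial>lborel)"
proof -
  define a where "a = frac x"
  have a: "0 \<le> a" "a < 1" by (simp_all add: a_def frac_lt_1)
  have frac_xy: "frac (x + y) = (if y < 1 - a then a + y else a + y - 1)" if "0 \<le> y" "y < 1" for y
  proof -
    have "frac (x + y) = frac (a + y)"
      by (simp add: a_def frac_def add.commute diff_add_eq[symmetric] floor_diff_of_int
            flip: of_int_diff) (simp add: algebra_simps)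
    also have "\<dots> = (if y < 1 - a then a + y else a + y - 1)"
      using a that by (auto simp: frac_unique_iff)
    finally show ?thesis .
  qed
  have "(\<integral>\<^sup>+y. indicator {0..<1} y * h (frac (x + y)) \<partial>lborel)
          = (\<integral>\<^sup>+y. indicator {0..<1-a} y * h (a + y) + indicator {1-a..<1} y * h (a + y - 1) \<partial>lborel)"
    using a by (intro nn_integral_cong) (auto simp: indicator_def frac_xy)
  also have "\<dots> = (\<integral>\<^sup>+y. indicator {0..<1-a} y * h (a + y) \<partial>lborel)
                   + (\<integral>\<^sup>+y. indicator {1-a..<1} y * h (a + y - 1) \<partial>lborel)"
    by (rule nn_integral_add) auto
  also have "(\<integral>\<^sup>+y. indicator {0..<1-a} y * h (a + y) \<partial>lborel)
               = (\<integral>\<^sup>+u. indicator {a..<1} u * h u \<partial>lborel)"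
    by (subst (2) nn_integral_real_affine[where c = 1 and t = a])
       (auto intro!: nn_integral_cong simp: indicator_def)
  also have "(\<integral>\<^sup>+y. indicator {1-a..<1} y * h (a + y - 1) \<partial>lborel)
               = (\<integral>\<^sup>+u. indicator {0..<a} u * h u \<partial>lborel)"
    by (subst (2) nn_integral_real_affine[where c = 1 and t = "a - 1"])
       (auto intro!: nn_integral_cong simp: indicator_def algebra_simps)
  also have "(\<integral>\<^sup>+u. indicator {a..<1} u * h u \<partial>lborel) + (\<integral>\<^sup>+u. indicator {0..<a} u * h u \<partial>lborel)
               = (\<integral>\<^sup>+u. indicator {a..<1} u * h u + indicator {0..<a} u * h u \<partial>lborel)"
    by (rule nn_integral_add[symmetric]) auto
  also have "\<dots> = (\<integral>\<^sup>+u. indicator {0..<1} u * h u \<partial>lborel)"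
    using a by (intro nn_integral_cong) (auto simp: indicator_def)
  finally show ?thesis .
qed

lemma (in prob_space) distributed_frac_add:
  fixes X Y :: "'a \<Rightarrow> real"
  assumes indep: "indep_var borel X borel Y"
    and X: "distributed M lborel X p"
    and Y: "distributed M lborel Y (\<lambda>y. indicator {0..<1} y * q y)"
    and q [measurable]: "q \<in> borel_measurable borel"
  shows "distributed M lborel (\<lambda>\<omega>. frac (X \<omega> + Y \<omega>))
           (\<lambda>u. indicator {0..<1} u * (\<integral>\<^sup>+v. p v * q (frac (u - v)) \<partial>lborel))"
proof -
  have [measurable]: "p \<in> borel_measurable borel"
    using distributed_borel_measurable[OF X] by simp
  have [measurable]: "X \<in> borel_measurable M" "Y \<in> borel_measurable M"
    using distributed_measurable[OF X] distributed_measurable[OF Y] by simp_all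
  let ?r = "\<lambda>u. indicator {0..<1} u * (\<integral>\<^sup>+v. p v * q (frac (u - v)) \<partial>lborel)"
  have "indep_var lborel X lborel Y"
    using indep_var_compose[OF indep, of id lborel id lborel] by simp
  hence XY: "distributed M (lborel \<Otimes>\<^sub>M lborel) (\<lambda>\<omega>. (X \<omega>, Y \<omega>))
               (\<lambda>(x, y). p x * (indicator {0..<1} y * q y))"
    by (intro distributed_joint_indep X Y lborel.sigma_finite_measure_axioms)
  have "distr M lborel (\<lambda>\<omega>. frac (X \<omega> + Y \<omega>)) = density lborel ?r"
  proof (rule measure_eqI)
    fix A assume "A \<in> sets (distr M lborel (\<lambda>\<omega>. frac (X \<omega> + Y \<omega>)))"
    hence [measurable]: "A \<in> sets borel" by simp
    have "emeasure (distr M lborel (\<lambda>\<omega>. frac (X \<omega> + Y \<omega>))) A =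
            (\<integral>\<^sup>+z. indicator A z \<partial>distr M lborel (\<lambda>\<omega>. frac (X \<omega> + Y \<omega>)))"
      by simp
    also have "\<dots> = (\<integral>\<^sup>+\<omega>. indicator A (frac (X \<omega> + Y \<omega>)) \<partial>M)"
      by (rule nn_integral_distr) simp_all
    also have "\<dots> = (\<integral>\<^sup>+z. (case z of (x, y) \<Rightarrow> p x * (indicator {0..<1} y * q y)) *
                        indicator A (frac (fst z + snd z)) \<partial>(lborel \<Otimes>\<^sub>M lborel))"
      by (subst distributed_nn_integral[OF XY]) simp_all
    also have "\<dots> = (\<integral>\<^sup>+x. \<integral>\<^sup>+y. p x * (indicator {0..<1} y * q y) * indicator A (frac (x + y))
                        \<partial>lborel \<partial>lborel)"
      by (subst lborel.nn_integral_fst[symmetric]) simp_all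
    also have "\<dots> = (\<integral>\<^sup>+x. \<integral>\<^sup>+u. indicator {0..<1} u * (p x * q (frac (u - x)) * indicator A u)
                        \<partial>lborel \<partial>lborel)"
    proof (rule nn_integral_cong)
      fix x :: real
      have "(\<integral>\<^sup>+y. p x * (indicator {0..<1} y * q y) * indicator A (frac (x + y)) \<partial>lborel) =
              (\<integral>\<^sup>+y. indicator {0..<1} y * (p x * q (frac (frac (x + y) - x)) * indicator A (frac (x + y)))
                 \<partial>lborel)"
      proof (intro nn_integral_cong)
        fix y :: real
        have "frac (frac (x + y) - x) = y" if "0 \<le> y" "y < 1"
          unfolding frac_unique_iff using that by (simp add: frac_def)
        thus "p x * (indicator {0..<1} y * q y) * indicator A (frac (x + y)) =
                indicator {0..<1} y * (p x * q (frac (frac (x + y) - x)) * indicator A (frac (x + y)))"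
          by (auto simp: indicator_def)
      qed
      also have "\<dots> = (\<integral>\<^sup>+u. indicator {0..<1} u * (p x * q (frac (u - x)) * indicator A u) \<partial>lborel)"
        by (rule nn_integral_frac_add) measurable
      finally show "(\<integral>\<^sup>+y. p x * (indicator {0..<1} y * q y) * indicator A (frac (x + y)) \<partial>lborel) =
          (\<integral>\<^sup>+u. indicator {0..<1} u * (p x * q (frac (u - x)) * indicator A u) \<partial>lborel)" .
    qed
    also have "\<dots> = (\<integral>\<^sup>+u. \<integral>\<^sup>+x. indicator {0..<1} u * (p x * q (frac (u - x)) * indicator A u)
                        \<partial>lborel \<partial>lborel)"
      by (rule lborel_pair.Fubini') measurable
    also have "\<dots> = (\<integral>\<^sup>+u. ?r u * indicator A u \<partial>lborel)"
      by (simp add: nn_integral_cmult nn_integral_multc) (simp add: mult.assoc)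
    also have "\<dots> = emeasure (density lborel ?r) A"
      by (simp add: emeasure_density)
    finally show "emeasure (distr M lborel (\<lambda>\<omega>. frac (X \<omega> + Y \<omega>))) A = emeasure (density lborel ?r) A" .
  qed simp
  thus ?thesis
    by (simp add: distributed_def)
qed

lemma distributed_circle_lborel:
  assumes Z: "distributed M lborel Z (\<lambda>u. indicator {0..<1} u * g u)"
    and range: "\<And>\<omega>. Z \<omega> \<in> {0..<1}"
    and [measurable]: "g \<in> borel_measurable borel"
  shows "distributed M circle_lborel Z g"
proof -
  have [measurable]: "Z \<in> borel_measurable M"
    using distributed_measurable[OF Z] by simp
  have "distr M circle_lborel Z = restrict_space (distr M lborel Z) {0..<1}"
    unfolding circle_lborel_def using range by (intro restrict_distr[symmetric]) auto
  also have "\<dots> = restrict_space (density lborel (\<lambda>u. indicator {0..<1} u * g u)) {0..<1}"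
    by (simp add: distributed_distr_eq_density[OF Z])
  also have "\<dots> = density circle_lborel g"
  proof (rule measure_eqI)
    fix A assume "A \<in> sets (restrict_space (density lborel (\<lambda>u. indicator {0..<1} u * g u)) {0..<1})"
    hence A: "A \<in> sets borel" "A \<subseteq> {0..<1}"
      by (auto simp: sets_restrict_space_iff)
    have "A \<in> sets circle_lborel"
      using A by (simp add: circle_lborel_def sets_restrict_space_iff)
    moreover have "g \<in> borel_measurable circle_lborel"
      unfolding circle_lborel_def by (intro measurable_restrict_space1) simp
    ultimately have "emeasure (density circle_lborel g) A = (\<integral>\<^sup>+u. g u * indicator A u \<partial>circle_lborel)"
      by (simp add: emeasure_density)
    also have "\<dots> = (\<integral>\<^sup>+u. g u * indicator A u * indicator {0..<1} u \<partial>lborel)"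
      unfolding circle_lborel_def by (simp add: nn_integral_restrict_space)
    also have "\<dots> = emeasure (density lborel (\<lambda>u. indicator {0..<1} u * g u)) A"
      using A by (simp add: emeasure_density mult_ac)
    finally show "emeasure (restrict_space (density lborel (\<lambda>u. indicator {0..<1} u * g u)) {0..<1}) A
                    = emeasure (density circle_lborel g) A"
      using A by (simp add: emeasure_restrict_space)
  qed (simp add: circle_lborel_def sets_restrict_space)
  finally show ?thesis
    unfolding distributed_def using range
    by (auto simp: circle_lborel_def intro!: measurable_restrict_space1 measurable_restrict_space2)
qed

section \<open>Sums of independent beta variables on the circle\<close>

lemma beta_1_2_density_AE_eq:
  "AE v in lborel. beta_1_2_density v = indicator {0..<1} v * (2 * (1 - v))"
  using AE_lborel_singleton[of "0::real"]
  by eventually_elim (auto simp: beta_1_2_density_def indicator_def)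

lemma (in prob_space) distributed_frac_sum_beta_1_2:
  fixes X :: "nat \<Rightarrow> 'a \<Rightarrow> real"
  assumes n: "n \<ge> 1"
    and indep: "indep_vars (\<lambda>_. borel) X {1..n}"
    and beta: "\<And>i. i \<in> {1..n} \<Longrightarrow> distributed M lborel (X i) (\<lambda>x. ennreal (beta_1_2_density x))"
  shows "distributed M lborel (\<lambda>\<omega>. frac (\<Sum>i=1..n. X i \<omega>))
           (\<lambda>u. indicator {0..<1} u * ennreal (1 - 2 ^ n * norm_bernpoly n u))"
  using assms
proof (induction n rule: dec_induct)
  case base
  let ?p = "\<lambda>x. ennreal (beta_1_2_density x)"
  have X: "distributed M lborel (X 1) ?p"
    by (rule base) simp
  have [measurable]: "X 1 \<in> borel_measurable M"
    using distributed_measurable[OF X] by simp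
  \<comment> \<open>The density vanishes off \<open>(0,1)\<close>, so taking the fractional part changes nothing almost surely.\<close>
  have "AE \<omega> in M. frac (X 1 \<omega>) = X 1 \<omega>"
  proof (subst distributed_AE2[OF X])
    show "AE x in lborel. 0 < ?p x \<longrightarrow> frac x = x"
      by (auto simp: beta_1_2_density_def frac_eq)
  qed measurable
  hence "distr M lborel (\<lambda>\<omega>. frac (X 1 \<omega>)) = distr M lborel (X 1)"
    by (intro distr_cong_AE) (simp_all del: One_nat_def)
  hence "distributed M lborel (\<lambda>\<omega>. frac (X 1 \<omega>)) ?p"
    using X by (auto simp: distributed_def)
  moreover have "AE u in lborel. ?p u = indicator {0..<1} u * ennreal (1 - 2 ^ 1 * norm_bernpoly 1 u)"
    using beta_1_2_density_AE_eq
    by eventually_elim (auto simp: norm_bernpoly_1 indicator_def simp del: One_nat_def)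
  ultimately show ?case
    using distributed_borel_measurable[OF X]
    by (subst distributed_cong_density[symmetric]) simp_all
next
  case (step n)
  let ?p = "\<lambda>x. ennreal (beta_1_2_density x)"
  let ?S = "\<lambda>\<omega>. \<Sum>i=1..n. X i \<omega>"
  let ?g = "\<lambda>n u. 1 - 2 ^ n * norm_bernpoly n u"
  have X: "distributed M lborel (X (Suc n)) ?p"
    by (rule step) simp
  have [measurable]: "beta_1_2_density \<in> borel_measurable borel"
    unfolding beta_1_2_density_def[abs_def] by measurable
  have "indep_vars (\<lambda>_. borel) X {1..n}"
    by (rule indep_vars_subset[OF step.prems(1)]) simp
  hence S: "distributed M lborel (\<lambda>\<omega>. frac (?S \<omega>)) (\<lambda>u. indicator {0..<1} u * ennreal (?g n u))"
    by (intro step.IH step.prems(2)) auto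
  have "indep_var borel (X (Suc n)) borel ?S"
    using step.prems(1) by (intro indep_vars_sum) (simp_all add: atLeastAtMostSuc_conv)
  hence "indep_var borel (id \<circ> X (Suc n)) borel (frac \<circ> ?S)"
    by (rule indep_var_compose) auto
  hence "distributed M lborel (\<lambda>\<omega>. frac (X (Suc n) \<omega> + frac (?S \<omega>)))
           (\<lambda>u. indicator {0..<1} u * (\<integral>\<^sup>+v. ?p v * ennreal (?g n (frac (u - v))) \<partial>lborel))"
    by (intro distributed_frac_add X S) (simp_all add: comp_def)
  also have "(\<lambda>\<omega>. frac (X (Suc n) \<omega> + frac (?S \<omega>))) = (\<lambda>\<omega>. frac (\<Sum>i=1..Suc n. X i \<omega>))"
    by (simp add: frac_add_simps(2) add.commute)
  also have "(\<lambda>u. indicator {0..<1} u * (\<integral>\<^sup>+v. ?p v * ennreal (?g n (frac (u - v))) \<partial>lborel)) =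
             (\<lambda>u. indicator {0..<1} u * ennreal (?g (Suc n) u))"
  proof
    fix u :: real
    show "indicator {0..<1} u * (\<integral>\<^sup>+v. ?p v * ennreal (?g n (frac (u - v))) \<partial>lborel) =
            indicator {0..<1} u * ennreal (?g (Suc n) u)"
    proof (cases "u \<in> {0..<1}")
      case True
      let ?h = "\<lambda>v. indicator {0..<1} v * (2 * (1 - v) * ?g n (frac (u - v)))"
      have nonneg: "?g n (frac x) \<ge> 0" for x
        using step.hyps by (intro norm_bernpoly_conv_pow_nonneg) (auto simp: frac_lt_1)
      have h: "has_bochner_integral lborel ?h (?g (Suc n) u)"
        using step.hyps True by (intro has_bochner_integral_conv_bernoulli)
      have "(\<integral>\<^sup>+v. ?p v * ennreal (?g n (frac (u - v))) \<partial>lborel) = (\<integral>\<^sup>+v. ennreal (?h v) \<partial>lborel)"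
      proof (rule nn_integral_cong_AE)
        show "AE v in lborel. ?p v * ennreal (?g n (frac (u - v))) = ennreal (?h v)"
          using beta_1_2_density_AE_eq
        proof eventually_elim
          case (elim v)
          thus ?case using nonneg[of "u - v"]
            by (auto simp: indicator_def ennreal_mult)
        qed
      qed
      also have "\<dots> = ennreal (?g (Suc n) u)"
        using h nonneg by (subst nn_integral_eq_integral) (auto simp: has_bochner_integral_iff indicator_def)
      finally show ?thesis by simp
    qed auto
  qed
  finally show ?case .
qed

theorem corollary3p1:
  fixes n :: nat
  assumes "n \<ge> 1"
  shows "(\<forall>(M :: 'a measure) (X :: nat \<Rightarrow> 'a \<Rightarrow> real).
            prob_space M \<longrightarrow>
            prob_space.indep_vars M (\<lambda>_. borel) X {1..n} \<longrightarrow>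
            (\<forall>i\<in>{1..n}. distributed M lborel (X i) (\<lambda>x. ennreal (beta_1_2_density x))) \<longrightarrow>
            distributed M circle_lborel (\<lambda>\<omega>. frac (\<Sum>i=1..n. X i \<omega>))
              (\<lambda>u. ennreal (circ_conv_pow (\<lambda>x. 1 - 2 * norm_bernpoly 1 x) n u))) \<and>
         (\<forall>u\<in>{0..<1}. circ_conv_pow (\<lambda>x. 1 - 2 * norm_bernpoly 1 x) n u \<ge> 0) \<and>
         (\<forall>u\<in>{0..<1}. circ_conv_pow (\<lambda>x. 1 - 2 * norm_bernpoly 1 x) n u
                        = 1 - 2 ^ n * norm_bernpoly n u)"
proof (intro conjI allI impI ballI)
  fix M :: "'a measure" and X :: "nat \<Rightarrow> 'a \<Rightarrow> real"
  assume M: "prob_space M" and indep: "prob_space.indep_vars M (\<lambda>_. borel) X {1..n}"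
    and beta: "\<forall>i\<in>{1..n}. distributed M lborel (X i) (\<lambda>x. ennreal (beta_1_2_density x))"
  let ?S = "\<lambda>\<omega>. frac (\<Sum>i=1..n. X i \<omega>)"
  let ?d = "\<lambda>u. ennreal (circ_conv_pow (\<lambda>x. 1 - 2 * norm_bernpoly 1 x) n u)"
  have "distributed M circle_lborel ?S (\<lambda>u. ennreal (1 - 2 ^ n * norm_bernpoly n u))"
    using prob_space.distributed_frac_sum_beta_1_2[OF M assms indep] beta
    by (intro distributed_circle_lborel) (auto simp: frac_lt_1)
  moreover have eq: "?d u = ennreal (1 - 2 ^ n * norm_bernpoly n u)" if "u \<in> space circle_lborel" for u
    using that assms
    by (simp add: circle_lborel_def space_restrict_space circ_conv_pow_eq_norm_bernpoly del: One_nat_def)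
  ultimately show "distributed M circle_lborel ?S ?d"
    unfolding distributed_def
    by (auto simp: eq cong: measurable_cong intro!: density_cong)
next
  fix u :: real assume "u \<in> {0..<1}"
  thus "circ_conv_pow (\<lambda>x. 1 - 2 * norm_bernpoly 1 x) n u = 1 - 2 ^ n * norm_bernpoly n u"
       "circ_conv_pow (\<lambda>x. 1 - 2 * norm_bernpoly 1 x) n u \<ge> 0"
    using assms circ_conv_pow_eq_norm_bernpoly norm_bernpoly_conv_pow_nonneg by simp_all
qed

end
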